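(* Let $F=(0,0)$ and let $\mathcal{F}=\{\mathcal{P}(p)\mid p\in\mathbb{R}\setminus\{0\}\}$ be the confocal family of parabolas $\mathcal{P}(p): y^2=2px+p^2$. Let $E\in\mathbb{R}^2$ and let $\mathcal{D}(E)$ be the unit circle centered at $E$. Then $\mathcal{F}$ is $3$-isoperiodic with $\mathcal{D}(E)$ if and only if $F\in\mathcal{D}(E)$.
   Context: Every parabola $\mathcal{P}(p)$ has focus $F=(0,0)$ and the $x$-axis as axis of symmetry. Real conics are identified with their complexifications in $\mathbb{CP}^2$, and polygons are taken in $\mathbb{CP}^2$ (vertices and sides may be non-real). For $n\ge 3$ and two smooth conics $\mathcal{C}_1,\mathcal{C}_2$, an $n$-Poncelet polygon is an $n$-gon ($n$ distinct vertices, $n$ distinct side lines) whose vertices lie on $\mathcal{C}_1$ and whose side lines are tangent to $\mathcal{C}_2$; a $k$-gon traversed $m>1$ times is not regarded as an $mk$-gon. The pair $(\mathcal{C}_1,\mathcal{C}_2)$ is an $n$-Poncelet pair if such an $n$-gon exists. A family $\mathcal{F}$ of nondegenerate conics is $n$-isoperiodic with a nondegenerate conic $\mathcal{D}$ if $(\mathcal{D},\mathcal{C})$ is an $n$-Poncelet pair for every nondegenerate conic $\mathcal{C}\in\mathcal{F}$. *)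

theory Defs
  imports "HOL-Analysis.Analysis"
begin

section \<open>The complex projective plane\<close>

definition proportional :: "complex^3 \<Rightarrow> complex^3 \<Rightarrow> bool" where
  "proportional v w \<longleftrightarrow> v \<noteq> 0 \<and> w \<noteq> 0 \<and> (\<exists>c. c \<noteq> 0 \<and> w = c *s v)"

lemma part_equivp_proportional: "part_equivp proportional"
proof (rule part_equivpI)
  have "(1 :: complex^3) \<noteq> 0"
    by (simp add: vec_eq_iff)
  then show "\<exists>v. proportional v v"
    by (auto simp: proportional_def intro!: exI[of _ 1])
  show "symp proportional"
  proof (rule sympI)
    fix v w assume "proportional v w"
    then obtain c where "v \<noteq> 0" "w \<noteq> 0" "c \<noteq> 0" "w = c *s v"
      by (auto simp: proportional_def)
    then show "proportional w v"
      by (auto simp: proportional_def vector_smult_assoc intro!: exI[of _ "inverse c"])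
  qed
  show "transp proportional"
  proof (rule transpI)
    fix u v w assume "proportional u v" "proportional v w"
    then obtain c d where "u \<noteq> 0" "w \<noteq> 0" "c \<noteq> 0" "v = c *s u" "d \<noteq> 0" "w = d *s v"
      by (auto simp: proportional_def)
    then show "proportional u w"
      by (auto simp: proportional_def vector_smult_assoc intro!: exI[of _ "d * c"])
  qed
qed

quotient_type cp2 = "complex^3" / partial: proportional
  by (rule part_equivp_proportional)

text \<open>The affine point \<open>(x, y)\<close> is \<open>[x : y : 1]\<close>.\<close>

lift_definition real_point :: "real^2 \<Rightarrow> cp2"
  is "\<lambda>X. vector [of_real (X$1), of_real (X$2), 1]"
  by (auto simp: proportional_def vec_eq_iff forall_3 intro!: exI[of _ 1])

text \<open>The pairing \<^const>\<open>scalar_product\<close> is bilinear, without complex conjugation.\<close>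

lift_definition incident :: "complex^3 \<Rightarrow> cp2 \<Rightarrow> bool"
  is "\<lambda>u v. scalar_product u v = 0"
proof -
  fix u v v' assume "proportional v v'"
  then obtain c where c: "c \<noteq> 0" "v' = c *s v"
    by (auto simp: proportional_def)
  have "scalar_product u v' = c * scalar_product u v"
    by (simp add: c scalar_product_def sum_3 algebra_simps)
  then show "(scalar_product u v = 0) = (scalar_product u v' = 0)"
    using c by simp
qed

definition proj_lines :: "cp2 set set" where
  "proj_lines = {{P. incident u P} |u. u \<noteq> 0}"


section \<open>Conics\<close>

text \<open>
  A conic is given by the symmetric matrix \<open>A\<close> of its homogeneous equation \<open>v\<^sup>T A v = 0\<close>.
  All notions below are unchanged if \<open>A\<close> is multiplied by a nonzero scalar.
\<close>

definition nondegenerate_conic :: "complex^3^3 \<Rightarrow> bool" where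
  "nondegenerate_conic A \<longleftrightarrow> transpose A = A \<and> det A \<noteq> 0"

lift_definition conjugate_points :: "complex^3^3 \<Rightarrow> cp2 \<Rightarrow> cp2 \<Rightarrow> bool"
  is "\<lambda>A v w. scalar_product v (A *v w) = 0"
proof -
  fix A :: "complex^3^3" and v v' w w'
  assume "proportional v v'" "proportional w w'"
  then obtain c d where c: "c \<noteq> 0" "v' = c *s v" and d: "d \<noteq> 0" "w' = d *s w"
    by (auto simp: proportional_def)
  have "scalar_product v' (A *v w') = c * d * scalar_product v (A *v w)"
    by (simp add: c d scalar_product_def matrix_vector_mult_def sum_3 algebra_simps)
  then show "(scalar_product v (A *v w) = 0) = (scalar_product v' (A *v w') = 0)"
    using c d by simp
qed

definition conic_points :: "complex^3^3 \<Rightarrow> cp2 set" where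
  "conic_points A = {P. conjugate_points A P P}"

text \<open>
  At \<open>P = [v]\<close> on the conic, the gradient of the equation is \<open>2 A v\<close>, so the tangent at \<open>P\<close>
  is the line \<open>w\<^sup>T A v = 0\<close>.
\<close>

definition tangent_line_at :: "complex^3^3 \<Rightarrow> cp2 \<Rightarrow> cp2 set" where
  "tangent_line_at A P = {Q. conjugate_points A Q P}"

definition tangent_to_conic :: "cp2 set \<Rightarrow> complex^3^3 \<Rightarrow> bool" where
  "tangent_to_conic l A \<longleftrightarrow> (\<exists>P \<in> conic_points A. l = tangent_line_at A P)"

text \<open>
  The complexification of the real affine conic \<open>a x\<^sup>2 + b x y + c y\<^sup>2 + d x + e y + f = 0\<close>.
\<close>

definition real_conic :: "real \<Rightarrow> real \<Rightarrow> real \<Rightarrow> real \<Rightarrow> real \<Rightarrow> real \<Rightarrow> complex^3^3" where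
  "real_conic a b c d e f = map_matrix of_real
     (vector [vector [a,     b / 2, d / 2],
              vector [b / 2, c,     e / 2],
              vector [d / 2, e / 2, f    ]])"

lemma real_point_mem_real_conic:
  "real_point X \<in> conic_points (real_conic a b c d e f) \<longleftrightarrow>
     a * (X$1)\<^sup>2 + b * X$1 * X$2 + c * (X$2)\<^sup>2 + d * X$1 + e * X$2 + f = 0"
proof -
  define v :: "complex^3" where "v = vector [of_real (X$1), of_real (X$2), 1]"
  have "scalar_product v (real_conic a b c d e f *v v) =
    of_real (a * (X$1)\<^sup>2 + b * X$1 * X$2 + c * (X$2)\<^sup>2 + d * X$1 + e * X$2 + f)"
    by (simp add: v_def real_conic_def scalar_product_def matrix_vector_mult_def sum_3
          power2_eq_square field_simps)
  moreover have "real_point X \<in> conic_points (real_conic a b c d e f) \<longleftrightarrow>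
    scalar_product v (real_conic a b c d e f *v v) = 0"
    unfolding conic_points_def v_def mem_Collect_eq by transfer (rule refl)
  ultimately show ?thesis
    by (simp only: of_real_eq_0_iff)
qed


section \<open>Poncelet polygons\<close>

text \<open>
  Vertices \<open>V 0, \<dots>, V (n - 1)\<close>; the side \<open>S i\<close> joins \<open>V i\<close> and \<open>V (i + 1)\<close>, cyclically. Since the
  vertices are distinct, the sides are determined by them.
\<close>

definition proj_polygon :: "nat \<Rightarrow> (nat \<Rightarrow> cp2) \<Rightarrow> (nat \<Rightarrow> cp2 set) \<Rightarrow> bool" where
  "proj_polygon n V S \<longleftrightarrow> n \<ge> 3 \<and> inj_on V {..<n} \<and> inj_on S {..<n} \<and>
     (\<forall>i<n. S i \<in> proj_lines \<and> V i \<in> S i \<and> V (Suc i mod n) \<in> S i)"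

definition poncelet_polygon ::
  "nat \<Rightarrow> complex^3^3 \<Rightarrow> complex^3^3 \<Rightarrow> (nat \<Rightarrow> cp2) \<Rightarrow> (nat \<Rightarrow> cp2 set) \<Rightarrow> bool" where
  "poncelet_polygon n A B V S \<longleftrightarrow> proj_polygon n V S \<and>
     (\<forall>i<n. V i \<in> conic_points A \<and> tangent_to_conic (S i) B)"

definition poncelet_pair :: "nat \<Rightarrow> complex^3^3 \<Rightarrow> complex^3^3 \<Rightarrow> bool" where
  "poncelet_pair n A B \<longleftrightarrow> nondegenerate_conic A \<and> nondegenerate_conic B \<and>
     (\<exists>V S. poncelet_polygon n A B V S)"

definition isoperiodic :: "nat \<Rightarrow> (complex^3^3) set \<Rightarrow> complex^3^3 \<Rightarrow> bool" where
  "isoperiodic n \<F> D \<longleftrightarrow> nondegenerate_conic D \<and> (\<forall>C\<in>\<F>. nondegenerate_conic C) \<and>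
     (\<forall>C\<in>\<F>. poncelet_pair n D C)"


section \<open>Confocal parabolas and unit circles\<close>

definition confocal_parabola :: "real \<Rightarrow> complex^3^3" where
  "confocal_parabola p = real_conic 0 0 1 (- 2 * p) 0 (- p\<^sup>2)"

definition confocal_parabolas :: "(complex^3^3) set" where
  "confocal_parabolas = {confocal_parabola p |p. p \<noteq> 0}"

definition unit_circle_at :: "real^2 \<Rightarrow> complex^3^3" where
  "unit_circle_at E = real_conic 1 0 1 (- 2 * E$1) (- 2 * E$2) ((E$1)\<^sup>2 + (E$2)\<^sup>2 - 1)"

lemma real_point_mem_confocal_parabola:
  "real_point X \<in> conic_points (confocal_parabola p) \<longleftrightarrow> (X$2)\<^sup>2 = 2 * p * X$1 + p\<^sup>2"
  by (auto simp: confocal_parabola_def real_point_mem_real_conic)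

lemma real_point_mem_unit_circle_at:
  "real_point X \<in> conic_points (unit_circle_at E) \<longleftrightarrow> X \<in> sphere E 1"
proof -
  have "X \<in> sphere E 1 \<longleftrightarrow> (E$1 - X$1)\<^sup>2 + (E$2 - X$2)\<^sup>2 = 1"
    by (simp add: dist_norm norm_eq_sqrt_inner inner_vec_def sum_2 power2_eq_square)
  then show ?thesis
    by (simp add: unit_circle_at_def real_point_mem_real_conic power2_eq_square algebra_simps)
qed

lemma nondegenerate_confocal_parabola: "p \<noteq> 0 \<Longrightarrow> nondegenerate_conic (confocal_parabola p)"
  by (simp add: nondegenerate_conic_def confocal_parabola_def real_conic_def det_3
        transpose_def vec_eq_iff forall_3)

lemma nondegenerate_unit_circle_at: "nondegenerate_conic (unit_circle_at E)"
  by (simp add: nondegenerate_conic_def unit_circle_at_def real_conic_def det_3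
        transpose_def vec_eq_iff forall_3 power2_eq_square)

end

theory Submission
  imports Defs
begin

text \<open>
  The two circular points and the focus \<open>F\<close> span a triangle whose sides, the line at infinity and
  the two isotropic lines through \<open>F\<close>, are tangent to every parabola with focus \<open>F\<close>. Every circle
  contains the circular points, so this is a Poncelet triangle as soon as \<open>F\<close> is on the circle.

  Conversely, the tangents of a parabola are parametrized by \<open>[s : t]\<close> so that the intersection of
  two of them is a symmetric bilinear expression in the parameters. The condition that two tangents
  meet on the circle is then biquadratic, and imposing it on the three pairs of three distinct
  tangents forces the power of \<open>F\<close> with respect to the circle to vanish. This is the classical
  fact that the circumcircle of a triangle of tangents passes through the focus, but valid for
  non-real triangles and for triangles with vertices at infinity.
\<close>

section \<open>Points and lines in coordinates\<close>

lemma proportional_refl: "v \<noteq> 0 \<Longrightarrow> proportional v v"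
  by (auto simp: proportional_def intro!: exI[of _ 1])

lemma cp2_cases:
  obtains v where "P = abs_cp2 v" "v \<noteq> 0"
  by (induction P rule: cp2.abs_induct) (auto simp: proportional_def)

lemma scalar_product_3:
  "scalar_product (u :: complex^3) v = u$1 * v$1 + u$2 * v$2 + u$3 * v$3"
  by (simp add: scalar_product_def sum_3)

lemma vec3_eq_0_iff: "v = 0 \<longleftrightarrow> v$1 = 0 \<and> v$2 = 0 \<and> v$3 = 0" for v :: "complex^3"
  by (simp add: vec_eq_iff forall_3)

lemma incident_abs: "v \<noteq> 0 \<Longrightarrow> incident u (abs_cp2 v) \<longleftrightarrow> scalar_product u v = 0"
  by (rule incident.abs_eq) (rule proportional_refl)

lemma conjugate_points_abs:
  "v \<noteq> 0 \<Longrightarrow> w \<noteq> 0 \<Longrightarrow>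
    conjugate_points A (abs_cp2 v) (abs_cp2 w) \<longleftrightarrow> scalar_product v (A *v w) = 0"
  by (rule conjugate_points.abs_eq) (auto intro: proportional_refl)

definition line :: "complex^3 \<Rightarrow> cp2 set" where
  "line u = {P. incident u P}"

lemma abs_mem_line: "v \<noteq> 0 \<Longrightarrow> abs_cp2 v \<in> line u \<longleftrightarrow> scalar_product u v = 0"
  by (simp add: line_def incident_abs)

lemma line_scale:
  assumes "k \<noteq> 0" "u' = k *s u"
  shows "line u' = line u"
proof (rule set_eqI)
  fix P
  obtain v where v: "P = abs_cp2 v" "v \<noteq> 0" by (rule cp2_cases)
  have "scalar_product u' v = k * scalar_product u v"
    by (simp add: assms scalar_product_3 algebra_simps)
  then show "P \<in> line u' \<longleftrightarrow> P \<in> line u"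
    using v assms by (simp add: abs_mem_line)
qed

lemma tangent_line_at_abs:
  assumes "transpose A = A" "v \<noteq> 0"
  shows "tangent_line_at A (abs_cp2 v) = line (A *v v)"
proof (rule set_eqI)
  fix P
  obtain w where w: "P = abs_cp2 w" "w \<noteq> 0" by (rule cp2_cases)
  show "P \<in> tangent_line_at A (abs_cp2 v) \<longleftrightarrow> P \<in> line (A *v v)"
    using w assms
    by (simp add: tangent_line_at_def conjugate_points_abs abs_mem_line scalar_product_3
        mult.commute)
qed

section \<open>The tangents of a parabola\<close>

text \<open>This parametrizes the dual conic p(u1^2 + u2^2) = 2 u1 u3 by the normal direction
  [s : t] of the tangent. The line at infinity is s = 0, and the isotropic tangents through F are t
  = \<plusminus> i s.\<close>

definition tangent_param :: "complex \<Rightarrow> complex \<Rightarrow> complex \<Rightarrow> cp2 set" where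
  "tangent_param p s t = line (vector [2 * s\<^sup>2, 2 * s * t, p * (s\<^sup>2 + t\<^sup>2)])"

lemma confocal_parabola_mult:
  "confocal_parabola p *v v =
    vector [- of_real p * v$3, v$2, - of_real p * v$1 - (of_real p)\<^sup>2 * v$3]"
  by (simp add: confocal_parabola_def real_conic_def matrix_vector_mult_def sum_3
      vec_eq_iff forall_3)

lemma abs_mem_confocal_parabola:
  assumes "v \<noteq> 0"
  shows "abs_cp2 v \<in> conic_points (confocal_parabola p) \<longleftrightarrow>
    (v$2)\<^sup>2 = 2 * of_real p * v$1 * v$3 + (of_real p)\<^sup>2 * (v$3)\<^sup>2"
proof -
  have "scalar_product v (confocal_parabola p *v v) =
    (v$2)\<^sup>2 - (2 * of_real p * v$1 * v$3 + (of_real p)\<^sup>2 * (v$3)\<^sup>2)"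
    by (simp add: confocal_parabola_mult scalar_product_3 power2_eq_square algebra_simps)
  then show ?thesis
    using assms by (simp add: conic_points_def conjugate_points_abs)
qed

lemma tangent_line_at_confocal_parabola:
  assumes "p \<noteq> 0" "v \<noteq> 0"
  shows "tangent_line_at (confocal_parabola p) (abs_cp2 v) =
    line (vector [- of_real p * v$3, v$2, - of_real p * v$1 - (of_real p)\<^sup>2 * v$3])"
  using assms nondegenerate_confocal_parabola[of p]
  by (simp add: tangent_line_at_abs nondegenerate_conic_def confocal_parabola_mult)

lemma tangent_to_confocal_parabola_iff:
  assumes p: "p \<noteq> 0"
  shows "tangent_to_conic l (confocal_parabola p) \<longleftrightarrow>
    (\<exists>s t. (s \<noteq> 0 \<or> t \<noteq> 0) \<and> l = tangent_param (of_real p) s t)"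
proof
  assume "tangent_to_conic l (confocal_parabola p)"
  then obtain v where v: "v \<noteq> 0" "abs_cp2 v \<in> conic_points (confocal_parabola p)"
    "l = tangent_line_at (confocal_parabola p) (abs_cp2 v)"
    unfolding tangent_to_conic_def by (metis cp2_cases)
  define u :: "complex^3" where
    "u = vector [- of_real p * v$3, v$2, - of_real p * v$1 - (of_real p)\<^sup>2 * v$3]"
  have l: "l = line u"
    using v p by (simp add: tangent_line_at_confocal_parabola u_def)
  have eq: "(v$2)\<^sup>2 = 2 * of_real p * v$1 * v$3 + (of_real p)\<^sup>2 * (v$3)\<^sup>2"
    using v by (simp add: abs_mem_confocal_parabola)
  show "\<exists>s t. (s \<noteq> 0 \<or> t \<noteq> 0) \<and> l = tangent_param (of_real p) s t"
  proof (cases "v$3 = 0")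
    case True
    then have "v$2 = 0" "v$1 \<noteq> 0" using eq v by (auto simp: vec3_eq_0_iff)
    then have "line u = tangent_param (of_real p) 0 1"
      unfolding tangent_param_def using True
      by (intro line_scale[of "- v$1"]) (auto simp: u_def vec_eq_iff forall_3)
    then show ?thesis using l by (metis zero_neq_one)
  next
    case False
    \<comment> \<open>The first two coordinates of a tangent vector are 2s(s, t), so [s : t] must be
      [u1 : u2]. The equation of the parabola then makes the third coordinate agree.\<close>
    have "of_real p * ((of_real p * v$3)\<^sup>2 + (v$2)\<^sup>2) =
        - 2 * of_real p * v$3 * (- of_real p * v$1 - (of_real p)\<^sup>2 * v$3)"
      unfolding eq by algebra
    then have "tangent_param (of_real p) (of_real p * v$3) (- v$2) = line u"
      unfolding tangent_param_def using False p
      by (intro line_scale[of "- 2 * of_real p * v$3"])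
        (simp_all add: u_def vec_eq_iff forall_3 power2_eq_square)
    then show ?thesis using l False p by (metis mult_eq_0_iff of_real_eq_0_iff)
  qed
next
  assume "\<exists>s t. (s \<noteq> 0 \<or> t \<noteq> 0) \<and> l = tangent_param (of_real p) s t"
  then obtain s t where st: "s \<noteq> 0 \<or> t \<noteq> 0" and l: "l = tangent_param (of_real p) s t"
    by blast
  \<comment> \<open>The point of contact is the formula for the intersection of two tangents at
    equal parameters.\<close>
  define v :: "complex^3" where
    "v = vector [of_real p * (t\<^sup>2 - s\<^sup>2), - 2 * of_real p * s * t, 2 * s\<^sup>2]"
  have v: "v \<noteq> 0" using st p by (auto simp: vec3_eq_0_iff v_def)
  have "abs_cp2 v \<in> conic_points (confocal_parabola p)"
    unfolding abs_mem_confocal_parabola[OF v] by (simp add: v_def) algebra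
  moreover have "tangent_line_at (confocal_parabola p) (abs_cp2 v) = l"
    unfolding tangent_line_at_confocal_parabola[OF p v] l tangent_param_def
    using p
    by (intro line_scale[of "- of_real p"])
      (simp_all add: v_def vec_eq_iff forall_3 power2_eq_square algebra_simps)
  ultimately show "tangent_to_conic l (confocal_parabola p)"
    unfolding tangent_to_conic_def by blast
qed

text \<open>Used contrapositively: distinct sides of a triangle have parameters with nonzero
  determinant.\<close>

lemma tangent_param_eqI:
  assumes "s \<noteq> 0 \<or> t \<noteq> 0" "s' \<noteq> 0 \<or> t' \<noteq> 0" "s * t' = s' * t"
  shows "tangent_param p s t = tangent_param p s' t'"
proof -
  have "\<exists>k. k \<noteq> 0 \<and> s = k * s' \<and> t = k * t'"
  proof (cases "s' = 0")
    case True
    then show ?thesis using assms by (auto intro!: exI[of _ "t / t'"])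
  next
    case False
    then show ?thesis using assms
      by (intro exI[of _ "s / s'"]) (auto simp: field_simps)
  qed
  then obtain k where "k \<noteq> 0" "s = k * s'" "t = k * t'" by blast
  then show ?thesis
    unfolding tangent_param_def
    by (intro line_scale[of "k\<^sup>2"])
      (auto simp: vec_eq_iff forall_3 power2_eq_square algebra_simps)
qed

text \<open>The cross product of the two line vectors is 2(st' - s't) times the vector (p(tt' -
  ss'), -p(st' + s't), 2ss').\<close>

lemma tangent_param_intersection:
  assumes p: "p \<noteq> 0" and d: "s * t' \<noteq> s' * t" and v: "v \<noteq> 0"
    and on: "abs_cp2 v \<in> tangent_param p s t" "abs_cp2 v \<in> tangent_param p s' t'"
  obtains k where "k \<noteq> 0" "v$1 = k * (p * (t * t' - s * s'))"
    "v$2 = k * (- p * (s * t' + s' * t))" "v$3 = k * (2 * s * s')"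
proof -
  have e: "2 * s\<^sup>2 * v$1 + 2 * s * t * v$2 + p * (s\<^sup>2 + t\<^sup>2) * v$3 = 0"
    "2 * s'\<^sup>2 * v$1 + 2 * s' * t' * v$2 + p * (s'\<^sup>2 + t'\<^sup>2) * v$3 = 0"
    using on v by (simp_all add: tangent_param_def abs_mem_line scalar_product_3)
  have "\<exists>k. v$1 = k * (p * (t * t' - s * s')) \<and>
    v$2 = k * (- p * (s * t' + s' * t)) \<and> v$3 = k * (2 * s * s')"
  proof -
    consider "s = 0" "s' \<noteq> 0" "t \<noteq> 0" | "s' = 0" "s \<noteq> 0" "t' \<noteq> 0" | "s \<noteq> 0" "s' \<noteq> 0"
      using d by (cases "s = 0"; cases "s' = 0") auto
    then show ?thesis
    proof cases
      \<comment> \<open>One tangent is the line at infinity, so v is the direction of the other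
        one.\<close>
      case 1
      then have z: "v$3 = 0" using e p by auto
      have "s' * (s' * v$1 + t' * v$2) = 0" using e(2) z by algebra
      then have "s' * v$1 = - t' * v$2" using 1 by algebra
      then show ?thesis using 1 z p
        by (intro exI[of _ "- v$2 / (p * s' * t)"]) (auto simp: field_simps)
    next
      case 2
      then have z: "v$3 = 0" using e p by auto
      have "s * (s * v$1 + t * v$2) = 0" using e(1) z by algebra
      then have "s * v$1 = - t * v$2" using 2 by algebra
      then show ?thesis using 2 z p
        by (intro exI[of _ "- v$2 / (p * s * t')"]) (auto simp: field_simps)
    next
      case 3
      \<comment> \<open>Eliminating \<open>v$1\<close> from the two equations leaves the determinant
        as a factor.\<close>
      have "(s * t' - s' * t) * (2 * s * s' * v$2 + p * (s * t' + s' * t) * v$3) = 0"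
        using e by algebra
      then have y: "2 * s * s' * v$2 = - p * (s * t' + s' * t) * v$3"
        using d by algebra
      have "s * (2 * s * s' * v$1 - p * (t * t' - s * s') * v$3) = 0"
        using e(1) y by algebra
      then have x: "2 * s * s' * v$1 = p * (t * t' - s * s') * v$3"
        using 3 by simp
      show ?thesis using 3 x y
        by (intro exI[of _ "v$3 / (2 * s * s')"]) (auto simp: field_simps)
    qed
  qed
  then obtain k where k: "v$1 = k * (p * (t * t' - s * s'))"
    "v$2 = k * (- p * (s * t' + s' * t))" "v$3 = k * (2 * s * s')" by blast
  moreover have "k \<noteq> 0" using k v by (auto simp: vec3_eq_0_iff)
  ultimately show ?thesis using that by blast
qed

section \<open>Tangents meeting on a circle\<close>

text \<open>
  The equation of the circle at the intersection of two tangents of \<open>\<P>(p)\<close>, divided by \<open>p\<^sup>2\<close>: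
  \<open>(a, b)\<close> is the center divided by \<open>p\<close>, and \<open>c\<close> is the power of the focus divided by \<open>p\<^sup>2\<close>.
\<close>

definition meet_on_circle ::
  "complex \<Rightarrow> complex \<Rightarrow> complex \<Rightarrow> complex \<Rightarrow> complex \<Rightarrow> complex \<Rightarrow> complex \<Rightarrow> bool" where
  "meet_on_circle a b c s t s' t' \<longleftrightarrow>
    (t\<^sup>2 + s\<^sup>2) * (t'\<^sup>2 + s'\<^sup>2) - 4 * a * (s * s') * (t * t' - s * s')
      + 4 * b * (s * s') * (s * t' + s' * t) + 4 * c * (s * s')\<^sup>2 = 0"

lemma meet_on_circle_commute: "meet_on_circle a b c s t s' t' \<longleftrightarrow> meet_on_circle a b c s' t' s t"
  by (simp add: meet_on_circle_def algebra_simps)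

lemma abs_mem_unit_circle_at:
  assumes "v \<noteq> 0"
  shows "abs_cp2 v \<in> conic_points (unit_circle_at E) \<longleftrightarrow>
    (v$1)\<^sup>2 + (v$2)\<^sup>2 - 2 * of_real (E$1) * v$1 * v$3 - 2 * of_real (E$2) * v$2 * v$3
      + of_real ((E$1)\<^sup>2 + (E$2)\<^sup>2 - 1) * (v$3)\<^sup>2 = 0"
proof -
  have "scalar_product v (unit_circle_at E *v v) =
    (v$1)\<^sup>2 + (v$2)\<^sup>2 - 2 * of_real (E$1) * v$1 * v$3 - 2 * of_real (E$2) * v$2 * v$3
      + of_real ((E$1)\<^sup>2 + (E$2)\<^sup>2 - 1) * (v$3)\<^sup>2"
    by (simp add: unit_circle_at_def real_conic_def matrix_vector_mult_def sum_3
        scalar_product_3 power2_eq_square algebra_simps)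
  then show ?thesis
    using assms by (simp add: conic_points_def conjugate_points_abs)
qed

lemma meet_on_circle_if_tangents_meet:
  assumes p: "p \<noteq> 0"
    and d: "s * t' \<noteq> s' * t"
    and on: "P \<in> tangent_param (of_real p) s t" "P \<in> tangent_param (of_real p) s' t'"
    and circle: "P \<in> conic_points (unit_circle_at E)"
  shows "meet_on_circle (of_real (E$1 / p)) (of_real (E$2 / p))
    (of_real (((E$1)\<^sup>2 + (E$2)\<^sup>2 - 1) / p\<^sup>2)) s t s' t'"
proof -
  obtain v where v: "P = abs_cp2 v" "v \<noteq> 0" by (rule cp2_cases)
  obtain k where k: "k \<noteq> 0" "v$1 = k * (of_real p * (t * t' - s * s'))"
    "v$2 = k * (- of_real p * (s * t' + s' * t))" "v$3 = k * (2 * s * s')"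
    using tangent_param_intersection[of "of_real p" s t' s' t v] p d v on by auto
  define a b c q :: complex where "a = of_real (E$1 / p)" "b = of_real (E$2 / p)"
    "c = of_real (((E$1)\<^sup>2 + (E$2)\<^sup>2 - 1) / p\<^sup>2)" "q = of_real p"
  have "of_real (E$1) = a * q" "of_real (E$2) = b * q"
    "complex_of_real ((E$1)\<^sup>2 + (E$2)\<^sup>2 - 1) = c * q\<^sup>2"
    using p by (simp_all add: a_b_c_q_def)
  then have "(v$1)\<^sup>2 + (v$2)\<^sup>2 - 2 * (a * q) * v$1 * v$3 - 2 * (b * q) * v$2 * v$3
      + c * q\<^sup>2 * (v$3)\<^sup>2 = 0"
    using circle v by (simp add: abs_mem_unit_circle_at)
  \<comment> \<open>The two squares combine by (tt' - ss')^2 + (st' + s't)^2 = (t^2 + s^2)(t'^2 +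
    s'^2).\<close>
  then have "(k * q)\<^sup>2 * ((t\<^sup>2 + s\<^sup>2) * (t'\<^sup>2 + s'\<^sup>2) - 4 * a * (s * s') * (t * t' - s * s')
      + 4 * b * (s * s') * (s * t' + s' * t) + 4 * c * (s * s')\<^sup>2) = 0"
    using k(2-4) unfolding a_b_c_q_def(4)[symmetric] by algebra
  then have "meet_on_circle a b c s t s' t'"
    using k p by (simp add: meet_on_circle_def a_b_c_q_def(4))
  then show ?thesis by (simp add: a_b_c_q_def)
qed

text \<open>Divided differences of the three conditions determine the center: 4a = e2 - 1 and 4b =
  e3 - e1, with ei the elementary symmetric functions of t1, t2, t3. Substituting these into one
  condition cancels everything but 4c, since (xy - 1)^2 + (x + y)^2 = (x^2 + 1)(y^2 + 1).\<close>

lemma power_zero_if_affine_tangents: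
  fixes a b c t1 t2 t3 :: complex
  assumes distinct: "t1 \<noteq> t2" "t1 \<noteq> t3" "t2 \<noteq> t3"
    and meet: "meet_on_circle a b c 1 t1 1 t2" "meet_on_circle a b c 1 t1 1 t3"
      "meet_on_circle a b c 1 t2 1 t3"
  shows "c = 0"
proof -
  have g12: "(t1\<^sup>2 + 1) * (t2\<^sup>2 + 1) - 4 * a * (t1 * t2 - 1) + 4 * b * (t1 + t2) + 4 * c = 0"
    and g13: "(t1\<^sup>2 + 1) * (t3\<^sup>2 + 1) - 4 * a * (t1 * t3 - 1) + 4 * b * (t1 + t3) + 4 * c = 0"
    and g23: "(t2\<^sup>2 + 1) * (t3\<^sup>2 + 1) - 4 * a * (t2 * t3 - 1) + 4 * b * (t2 + t3) + 4 * c = 0"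
    using meet by (simp_all add: meet_on_circle_def add.commute)
  have "(t2 - t3) * ((t1\<^sup>2 + 1) * (t2 + t3) - 4 * a * t1 + 4 * b) = 0"
    using g12 g13 by algebra
  then have h1: "(t1\<^sup>2 + 1) * (t2 + t3) - 4 * a * t1 + 4 * b = 0"
    using distinct by simp
  have "(t1 - t3) * ((t2\<^sup>2 + 1) * (t1 + t3) - 4 * a * t2 + 4 * b) = 0"
    using g12 g23 by algebra
  then have h2: "(t2\<^sup>2 + 1) * (t1 + t3) - 4 * a * t2 + 4 * b = 0"
    using distinct by simp
  have "(t1 - t2) * (t1 * t2 + t1 * t3 + t2 * t3 - 1 - 4 * a) = 0"
    using h1 h2 by algebra
  then have a: "4 * a = t1 * t2 + t1 * t3 + t2 * t3 - 1"
    using distinct by auto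
  have b: "4 * b = t1 * t2 * t3 - (t1 + t2 + t3)"
    using h1 a by algebra
  have "4 * c = 0" using g12 a b by algebra
  then show ?thesis by simp
qed

text \<open>Here one of the tangents is the line at infinity, so the other two are isotropic.\<close>

lemma power_zero_if_infinite_tangent:
  fixes a b c t s2 t2 s3 t3 :: complex
  assumes t: "t \<noteq> 0" and d: "s2 * t3 \<noteq> s3 * t2"
    and meet: "meet_on_circle a b c 0 t s2 t2" "meet_on_circle a b c 0 t s3 t3"
      "meet_on_circle a b c s2 t2 s3 t3"
  shows "c = 0"
proof -
  have e: "t2\<^sup>2 + s2\<^sup>2 = 0" "t3\<^sup>2 + s3\<^sup>2 = 0"
    using meet(1,2) t by (auto simp: meet_on_circle_def)
  have s: "s2 \<noteq> 0" "s3 \<noteq> 0" using e d by auto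
  \<comment> \<open>The ratios t2/s2 and t3/s3 are distinct square roots of -1, hence opposite with
    product 1.\<close>
  have "(s2 * t3 - s3 * t2) * (s2 * t3 + s3 * t2) = 0" using e by algebra
  then have sum: "s2 * t3 + s3 * t2 = 0" using d by simp
  have "s2 * (t2 * t3 - s2 * s3) = 0" using sum e by algebra
  then have "t2 * t3 - s2 * s3 = 0" using s by simp
  \<comment> \<open>The two isotropic tangents meet in F, where only the term with c
    survives.\<close>
  then show ?thesis using meet(3) e sum s by (simp add: meet_on_circle_def)
qed

text \<open>The condition is homogeneous of degree two in (s, t) and in (s', t').\<close>

lemma meet_on_circle_affine:
  assumes "s \<noteq> 0" "s' \<noteq> 0" "meet_on_circle a b c s t s' t'"
  shows "meet_on_circle a b c 1 (t / s) 1 (t' / s')"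
proof -
  obtain x y where xy: "t = x * s" "t' = y * s'"
    using assms by (metis nonzero_eq_divide_eq)
  have "(s * s')\<^sup>2 * ((x\<^sup>2 + 1) * (y\<^sup>2 + 1) - 4 * a * (x * y - 1) + 4 * b * (y + x) + 4 * c) = 0"
    using assms(3) unfolding meet_on_circle_def xy by algebra
  then show ?thesis using assms by (simp add: meet_on_circle_def xy)
qed

lemma power_zero_if_tangents_meet:
  fixes a b c :: complex
  assumes d: "s1 * t2 \<noteq> s2 * t1" "s1 * t3 \<noteq> s3 * t1" "s2 * t3 \<noteq> s3 * t2"
    and meet: "meet_on_circle a b c s1 t1 s2 t2" "meet_on_circle a b c s1 t1 s3 t3"
      "meet_on_circle a b c s2 t2 s3 t3"
  shows "c = 0"
proof -
  \<comment> \<open>By \<open>d\<close>, at most one of the three tangents is the line at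
    infinity.\<close>
  consider "s1 = 0" "t1 \<noteq> 0" | "s2 = 0" "t2 \<noteq> 0" | "s3 = 0" "t3 \<noteq> 0"
    | "s1 \<noteq> 0" "s2 \<noteq> 0" "s3 \<noteq> 0"
    using d by (cases "s1 = 0"; cases "s2 = 0"; cases "s3 = 0") auto
  then show ?thesis
  proof cases
    case 1
    then show ?thesis using meet d power_zero_if_infinite_tangent by blast
  next
    case 2
    then show ?thesis
      using meet d power_zero_if_infinite_tangent meet_on_circle_commute by metis
  next
    case 3
    then show ?thesis
      using meet d power_zero_if_infinite_tangent meet_on_circle_commute by metis
  next
    case 4
    show ?thesis
      by (rule power_zero_if_affine_tangents[of "t1 / s1" "t2 / s2" "t3 / s3" a b c])
        (use 4 d meet in \<open>auto simp: field_simps intro: meet_on_circle_affine\<close>)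
  qed
qed

section \<open>Poncelet triangles\<close>

lemma Suc_mod_3: "Suc 0 mod 3 = 1" "Suc 1 mod 3 = 2" "Suc 2 mod 3 = 0"
  by simp_all

lemma focus_on_circle_iff:
  "real_point 0 \<in> conic_points (unit_circle_at E) \<longleftrightarrow> (E$1)\<^sup>2 + (E$2)\<^sup>2 = 1"
  by (simp add: unit_circle_at_def real_point_mem_real_conic)

lemma focus_on_circle_if_poncelet_pair:
  assumes p: "p \<noteq> 0" and pair: "poncelet_pair 3 (unit_circle_at E) (confocal_parabola p)"
  shows "real_point 0 \<in> conic_points (unit_circle_at E)"
proof -
  obtain V S where poly: "poncelet_polygon 3 (unit_circle_at E) (confocal_parabola p) V S"
    using pair unfolding poncelet_pair_def by blast
  have inc: "V i \<in> S i" "V (Suc i mod 3) \<in> S i" if "i < 3" for i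
    using poly that unfolding poncelet_polygon_def proj_polygon_def by blast+
  have circle: "V i \<in> conic_points (unit_circle_at E)" if "i < 3" for i
    using poly that unfolding poncelet_polygon_def by blast
  have "\<forall>i<3. \<exists>s t. (s \<noteq> 0 \<or> t \<noteq> 0) \<and> S i = tangent_param (of_real p) s t"
    using poly p unfolding poncelet_polygon_def by (simp add: tangent_to_confocal_parabola_iff)
  then obtain s t where st: "s i \<noteq> 0 \<or> t i \<noteq> 0" "S i = tangent_param (of_real p) (s i) (t i)"
    if "i < 3" for i
    by metis
  have "inj_on S {..<3}"
    using poly unfolding poncelet_polygon_def proj_polygon_def by blast
  then have d: "s i * t j \<noteq> s j * t i" if "i < 3" "j < 3" "i \<noteq> j" for i j
    using that st tangent_param_eqI[of "s i" "t i" "s j" "t j" "of_real p"]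
    by (metis inj_on_contraD lessThan_iff)
  have meet: "meet_on_circle (of_real (E$1 / p)) (of_real (E$2 / p))
      (of_real (((E$1)\<^sup>2 + (E$2)\<^sup>2 - 1) / p\<^sup>2)) (s i) (t i) (s j) (t j)"
    if "i < 3" "j < 3" "i \<noteq> j" "k < 3" "V k \<in> S i" "V k \<in> S j" for i j k
    using meet_on_circle_if_tangents_meet[OF p d[of i j]] that circle st by metis
  \<comment> \<open>Consecutive sides share a vertex; sides 0 and 2 share vertex 0 cyclically. The
    third index given to \<open>meet\<close> below is this common vertex.\<close>
  have on: "V 1 \<in> S 0" "V 1 \<in> S 1" "V 2 \<in> S 1" "V 2 \<in> S 2" "V 0 \<in> S 0" "V 0 \<in> S 2"
    using inc[of 0] inc[of 1] inc[of 2] unfolding Suc_mod_3 by simp_all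
  have "complex_of_real (((E$1)\<^sup>2 + (E$2)\<^sup>2 - 1) / p\<^sup>2) = 0"
    by (rule power_zero_if_tangents_meet[OF d[of 0 1] d[of 0 2] d[of 1 2]
          meet[of 0 1 1] meet[of 0 2 0] meet[of 1 2 2]]) (use on in simp_all)
  then show ?thesis
    using p by (simp only: of_real_eq_0_iff focus_on_circle_iff) simp
qed

lemma poncelet_pair_if_focus_on_circle:
  assumes p: "p \<noteq> 0" and focus: "real_point 0 \<in> conic_points (unit_circle_at E)"
  shows "poncelet_pair 3 (unit_circle_at E) (confocal_parabola p)"
proof -
  \<comment> \<open>\<open>I\<close> and \<open>J\<close> are the circular points.\<close>
  define I J F :: "complex^3" where
    "I = vector [1, \<i>, 0]" "J = vector [1, - \<i>, 0]" "F = vector [0, 0, 1]"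
  define V where "V = (!) [abs_cp2 I, abs_cp2 J, abs_cp2 F]"
  \<comment> \<open>In order: the line at infinity \<open>I\<close> \<open>J\<close>, then the
    isotropic lines \<open>J\<close> \<open>F\<close> and \<open>F\<close> \<open>I\<close>.\<close>
  define S where "S = (!) [tangent_param (of_real p) 0 1,
    tangent_param (of_real p) 1 (- \<i>), tangent_param (of_real p) 1 \<i>]"
  have nz: "I \<noteq> 0" "J \<noteq> 0" "F \<noteq> 0"
    by (simp_all add: I_J_F_def vec3_eq_0_iff)
  have all3: "(\<forall>i<3. R i) \<longleftrightarrow> R 0 \<and> R 1 \<and> R 2" for R :: "nat \<Rightarrow> bool"
    by (auto simp: less_Suc_eq numeral_3_eq_3 numeral_2_eq_2)
  have inj3: "inj_on f {..<3} \<longleftrightarrow> f 0 \<noteq> f 1 \<and> f 0 \<noteq> f 2 \<and> f 1 \<noteq> f 2" for f :: "nat \<Rightarrow> 'a"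
    by (auto simp: inj_on_def all3 lessThan_iff Ball_def)
  \<comment> \<open>Each vertex misses exactly the opposite side, which also tells the three
    vertices, and the three sides, apart.\<close>
  have incidences:
    "abs_cp2 I \<in> S 0" "abs_cp2 J \<in> S 0" "abs_cp2 F \<notin> S 0"
    "abs_cp2 I \<notin> S 1" "abs_cp2 J \<in> S 1" "abs_cp2 F \<in> S 1"
    "abs_cp2 I \<in> S 2" "abs_cp2 J \<notin> S 2" "abs_cp2 F \<in> S 2"
    using p nz
    by (simp_all add: S_def tangent_param_def abs_mem_line scalar_product_3)
      (simp_all add: I_J_F_def mult.assoc)
  have V: "V 0 = abs_cp2 I" "V 1 = abs_cp2 J" "V 2 = abs_cp2 F"
    by (simp_all add: V_def)
  have "inj_on V {..<3}" "inj_on S {..<3}"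
    unfolding inj3 V using incidences by metis+
  moreover have "S i \<in> proj_lines" if "i < 3" for i
  proof -
    have "tangent_param (of_real p) s t \<in> proj_lines" if "s \<noteq> 0 \<or> t \<noteq> 0" for s t
      unfolding tangent_param_def line_def proj_lines_def using p that
      by (intro CollectI exI conjI refl) (auto simp: vec3_eq_0_iff)
    then show ?thesis using that
      by (auto simp: S_def less_Suc_eq numeral_3_eq_3)
  qed
  moreover have "\<forall>i<3. V i \<in> S i \<and> V (Suc i mod 3) \<in> S i"
    using incidences unfolding all3 Suc_mod_3 V by simp
  moreover have "\<forall>i<3. V i \<in> conic_points (unit_circle_at E)"
  proof -
    \<comment> \<open>\<open>I\<close> and \<open>J\<close> lie on every circle; for
      \<open>F\<close> the power with respect to the circle has to vanish.\<close>
    have "of_real ((E$1)\<^sup>2 + (E$2)\<^sup>2 - 1) = (0 :: complex)"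
      using focus unfolding focus_on_circle_iff by simp
    then show ?thesis
      unfolding all3 V abs_mem_unit_circle_at[OF nz(1)] abs_mem_unit_circle_at[OF nz(2)]
        abs_mem_unit_circle_at[OF nz(3)]
      by (simp add: I_J_F_def)
  qed
  moreover have "\<forall>i<3. tangent_to_conic (S i) (confocal_parabola p)"
    unfolding all3 tangent_to_confocal_parabola_iff[OF p]
    by (simp add: S_def) (metis zero_neq_one)
  ultimately have "poncelet_polygon 3 (unit_circle_at E) (confocal_parabola p) V S"
    unfolding poncelet_polygon_def proj_polygon_def by simp
  then show ?thesis
    unfolding poncelet_pair_def
    using nondegenerate_unit_circle_at nondegenerate_confocal_parabola[OF p] by blast
qed

theorem theorem3p2:
  fixes E :: "real^2"
  shows "isoperiodic 3 confocal_parabolas (unit_circle_at E) \<longleftrightarrow>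
    real_point 0 \<in> conic_points (unit_circle_at E)"
proof
  assume "isoperiodic 3 confocal_parabolas (unit_circle_at E)"
  \<comment> \<open>A Poncelet triangle for a single parabola already puts F on the circle; p = 1 is
    an arbitrary choice.\<close>
  then have "poncelet_pair 3 (unit_circle_at E) (confocal_parabola 1)"
    unfolding isoperiodic_def confocal_parabolas_def
    by (metis (mono_tags, lifting) mem_Collect_eq zero_neq_one)
  then show "real_point 0 \<in> conic_points (unit_circle_at E)"
    by (rule focus_on_circle_if_poncelet_pair[rotated]) simp
next
  assume "real_point 0 \<in> conic_points (unit_circle_at E)"
  then show "isoperiodic 3 confocal_parabolas (unit_circle_at E)"
    using poncelet_pair_if_focus_on_circle nondegenerate_unit_circle_at
      nondegenerate_confocal_parabola
    unfolding isoperiodic_def confocal_parabolas_def by blast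
qed

end
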